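(* Let $\mathcal{H}$ be a complex Hilbert space and let $T\in\mathcal{L}^h$ have closed range with positive orthogonal decomposition $T=T_1-T_2$. Then: (1) If $T_2\neq 0$, then $T=T_1-P_{T_2}-V$ (with $V=T_1-P_{T_2}-T$) is a proper splitting of $T$; moreover, this splitting converges if and only if $\|P_{T_2}-T_2\|<1$. (2) If $T_1\neq 0$, then $T=P_{T_1}-T_2-V$ (with $V=P_{T_1}-T_2-T$) is a proper splitting of $T$; moreover, this splitting converges if and only if $\|P_{T_1}-T_1\|<1$.
   Context: $\mathcal{L}(\mathcal{H})$ is the algebra of bounded linear operators on $\mathcal{H}$; $\mathcal{L}^h$ and $\mathcal{L}^+$ are the sets of selfadjoint and positive (semidefinite) operators in it; $\mathcal{R}(\cdot)$, $\mathcal{N}(\cdot)$ denote range and nullspace; $\rho(\cdot)$ is the spectral radius; $P_A$ is the orthogonal projection onto $\overline{\mathcal{R}(A)}$; $A^\dagger$ is the Moore-Penrose inverse of a closed range operator $A$. A proper splitting of $T$ is a decomposition $T=U-V$ with $U,V\in\mathcal{L}(\mathcal{H})$, $\mathcal{R}(U)=\mathcal{R}(T)$, $\mathcal{N}(U)=\mathcal{N}(T)$; it converges if $\rho(U^\dagger V)<1$. Here $U=T_1-P_{T_2}$ in (1) and $U=P_{T_1}-T_2$ in (2). The positive orthogonal decomposition of $T\in\mathcal{L}^h$ is the unique decomposition $T=T_1-T_2$ with $T_1,T_2\in\mathcal{L}^+$ and $\overline{\mathcal{R}(T_1)}\oplus\overline{\mathcal{R}(T_2)}=\overline{\mathcal{R}(T)}$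 (orthogonal sum); explicitly $T_1=\frac{|T|+T}{2}$, $T_2=\frac{|T|-T}{2}$. *)

theory Defs
  imports "HOL-Analysis.Analysis"
begin

(* Completeness and the topology come from the class banach; the norm is the one induced by the
   inner product, which is linear in its first argument. *)

class complex_hilbert_space = banach +
  fixes scaleC :: "complex \<Rightarrow> 'a \<Rightarrow> 'a" (infixr "*\<^sub>C" 75)
    and cinner :: "'a \<Rightarrow> 'a \<Rightarrow> complex"
  assumes scaleC_add_right: "c *\<^sub>C (x + y) = c *\<^sub>C x + c *\<^sub>C y"
    and scaleC_add_left: "(c + d) *\<^sub>C x = c *\<^sub>C x + d *\<^sub>C x"
    and scaleC_scaleC: "c *\<^sub>C (d *\<^sub>C x) = (c * d) *\<^sub>C x"
    and scaleC_of_real: "complex_of_real r *\<^sub>C x = r *\<^sub>R x"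
    and cinner_add_left: "cinner (x + y) z = cinner x z + cinner y z"
    and cinner_scaleC_left: "cinner (c *\<^sub>C x) y = c * cinner x y"
    and cinner_commute: "cinner x y = cnj (cinner y x)"
    and cinner_self: "cinner x x = complex_of_real ((norm x)\<^sup>2)"

(* The algebra of bounded complex-linear operators is a subset of the type of bounded real-linear
   maps, from which it inherits the vector space operations, the operator norm and composition. *)

definition bounded_ops :: "('a::complex_hilbert_space \<Rightarrow>\<^sub>L 'a) set" where
  "bounded_ops = {A :: 'a \<Rightarrow>\<^sub>L 'a. \<forall>c x. A (c *\<^sub>C x) = c *\<^sub>C A x}"

definition selfadjoint_ops :: "('a::complex_hilbert_space \<Rightarrow>\<^sub>L 'a) set" where
  "selfadjoint_ops = {A :: 'a \<Rightarrow>\<^sub>L 'a. A \<in> bounded_ops \<and> (\<forall>x y. cinner (A x) y = cinner x (A y))}"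

definition positive_ops :: "('a::complex_hilbert_space \<Rightarrow>\<^sub>L 'a) set" where
  "positive_ops = {A :: 'a \<Rightarrow>\<^sub>L 'a. A \<in> selfadjoint_ops \<and> (\<forall>x. 0 \<le> Re (cinner (A x) x))}"

definition nullspace :: "('a::complex_hilbert_space \<Rightarrow>\<^sub>L 'a) \<Rightarrow> 'a set" where
  "nullspace A = {x. A x = 0}"

definition range_proj :: "('a::complex_hilbert_space \<Rightarrow>\<^sub>L 'a) \<Rightarrow> ('a \<Rightarrow>\<^sub>L 'a)" where
  "range_proj A = (THE P :: 'a \<Rightarrow>\<^sub>L 'a. P \<in> bounded_ops \<and>
     (\<forall>x. P x \<in> closure (range A) \<and> (\<forall>z \<in> closure (range A). cinner (x - P x) z = 0)))"

(* Characterised by the four Penrose equations; meaningful when the range of A is closed. *)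

definition mp_inverse :: "('a::complex_hilbert_space \<Rightarrow>\<^sub>L 'a) \<Rightarrow> ('a \<Rightarrow>\<^sub>L 'a)" where
  "mp_inverse A = (THE X :: 'a \<Rightarrow>\<^sub>L 'a. X \<in> bounded_ops \<and>
     A o\<^sub>L X o\<^sub>L A = A \<and> X o\<^sub>L A o\<^sub>L X = X \<and>
     A o\<^sub>L X \<in> selfadjoint_ops \<and> X o\<^sub>L A \<in> selfadjoint_ops)"

definition op_spectrum :: "('a::complex_hilbert_space \<Rightarrow>\<^sub>L 'a) \<Rightarrow> complex set" where
  "op_spectrum A = {c. \<not> (\<exists>B \<in> bounded_ops :: ('a \<Rightarrow>\<^sub>L 'a) set. \<forall>x.
     B (c *\<^sub>C x - A x) = x \<and> c *\<^sub>C B x - A (B x) = x)}"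

(* The spectrum is empty only on the zero space; inserting 0 makes the radius 0 there. *)

definition op_spectral_radius :: "('a::complex_hilbert_space \<Rightarrow>\<^sub>L 'a) \<Rightarrow> real" where
  "op_spectral_radius A = Sup (insert 0 (cmod ` op_spectrum A))"

definition proper_splitting ::
  "('a::complex_hilbert_space \<Rightarrow>\<^sub>L 'a) \<Rightarrow> ('a \<Rightarrow>\<^sub>L 'a) \<Rightarrow> ('a \<Rightarrow>\<^sub>L 'a) \<Rightarrow> bool" where
  "proper_splitting T U V \<longleftrightarrow> U \<in> bounded_ops \<and> V \<in> bounded_ops \<and> T = U - V \<and>
     range U = range T \<and> nullspace U = nullspace T"

definition splitting_converges ::
  "('a::complex_hilbert_space \<Rightarrow>\<^sub>L 'a) \<Rightarrow> ('a \<Rightarrow>\<^sub>L 'a) \<Rightarrow> bool" where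
  "splitting_converges U V \<longleftrightarrow> op_spectral_radius (mp_inverse U o\<^sub>L V) < 1"

definition positive_orthogonal_decomposition ::
  "('a::complex_hilbert_space \<Rightarrow>\<^sub>L 'a) \<Rightarrow> ('a \<Rightarrow>\<^sub>L 'a) \<Rightarrow> ('a \<Rightarrow>\<^sub>L 'a) \<Rightarrow> bool" where
  "positive_orthogonal_decomposition T T1 T2 \<longleftrightarrow>
     T1 \<in> positive_ops \<and> T2 \<in> positive_ops \<and> T = T1 - T2 \<and>
     (\<forall>x \<in> closure (range T1). \<forall>y \<in> closure (range T2). cinner x y = 0) \<and>
     {x + y | x y. x \<in> closure (range T1) \<and> y \<in> closure (range T2)} = closure (range T)"

end

theory Submission
  imports Defs
begin

text \<open>Let \<open>P\<^sub>1\<close>, \<open>P\<^sub>2\<close> project onto the ranges of \<open>T\<^sub>1\<close>, \<open>T\<^sub>2\<close>, which are closed and orthogonal. Replacing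
  one of the \<open>T\<^sub>i\<close> by \<open>P\<^sub>i\<close> changes neither the range nor the nullspace of \<open>T\<^sub>1 - T\<^sub>2\<close>. For
  \<open>U = T\<^sub>1 - P\<^sub>2\<close> orthogonality gives \<open>V = T\<^sub>2 - P\<^sub>2 = U W\<close> with \<open>W = P\<^sub>2 - T\<^sub>2\<close>; since
  \<open>U\<^sup>\<dagger> U\<close> is the projection onto the range of \<open>U\<close>, which contains that of \<open>W\<close>, this means
  \<open>U\<^sup>\<dagger> V = W\<close>. Case (2) is the same with \<open>W = P\<^sub>1 - T\<^sub>1\<close>. As \<open>W\<close> is selfadjoint, its spectral
  radius is its norm. Boundedness of the projections and of \<open>U\<^sup>\<dagger>\<close> comes for free from the
  Hellinger-Toeplitz theorem.\<close>

section \<open>Geometry of complex Hilbert spaces\<close>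

lemma scaleC_one [simp]: "1 *\<^sub>C x = (x::'a::complex_hilbert_space)"
  using scaleC_of_real[of 1 x] by simp

lemma scaleC_zero_left [simp]: "0 *\<^sub>C x = (0::'a::complex_hilbert_space)"
  using scaleC_of_real[of 0 x] by simp

lemma scaleC_minus_one: "(-1) *\<^sub>C x = - (x::'a::complex_hilbert_space)"
  using scaleC_of_real[of "-1" x] by simp

lemma scaleC_diff_right: "c *\<^sub>C (x - y) = c *\<^sub>C x - c *\<^sub>C (y::'a::complex_hilbert_space)"
  using scaleC_add_right[of c "x - y" y] by (simp add: algebra_simps)

lemma cinner_zero_left [simp]: "cinner 0 (y::'a::complex_hilbert_space) = 0"
  using cinner_scaleC_left[of 0 0 y] by simp

lemma cinner_zero_right [simp]: "cinner (y::'a::complex_hilbert_space) 0 = 0"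
  using cinner_commute[of y 0] by simp

lemma cinner_diff_left: "cinner (x - y) z = cinner x z - cinner y (z::'a::complex_hilbert_space)"
  using cinner_add_left[of "x - y" y z] by simp

lemma cinner_add_right: "cinner z (x + y) = cinner z x + cinner z (y::'a::complex_hilbert_space)"
  by (metis cinner_add_left cinner_commute complex_cnj_add)

lemma cinner_diff_right: "cinner z (x - y) = cinner z x - cinner z (y::'a::complex_hilbert_space)"
  using cinner_add_right[of z "x - y" y] by simp

lemma cinner_scaleC_right: "cinner x (c *\<^sub>C y) = cnj c * cinner x (y::'a::complex_hilbert_space)"
  by (metis cinner_scaleC_left cinner_commute complex_cnj_mult)

lemma cinner_scaleR_right: "cinner x (r *\<^sub>R y) = r * cinner x (y::'a::complex_hilbert_space)"
  by (metis cinner_scaleC_right scaleC_of_real complex_cnj_complex_of_real)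

lemma cinner_eq_zero_swap: "cinner x y = 0 \<longleftrightarrow> cinner y (x::'a::complex_hilbert_space) = 0"
  by (metis cinner_commute complex_cnj_zero)

lemma cinner_self_eq_zero [simp]: "cinner x x = 0 \<longleftrightarrow> (x::'a::complex_hilbert_space) = 0"
  by (simp add: cinner_self)

lemma cinner_ext:
  assumes "\<And>z. cinner x z = cinner y (z::'a::complex_hilbert_space)"
  shows "x = y"
  using assms[of "x - y"] cinner_self_eq_zero[of "x - y"] by (simp add: cinner_diff_left)

text \<open>The class postulates homogeneity of the norm for real scalars only; complex scalars are
  handled through \<open>cinner_self\<close>.\<close>

lemma norm_scaleC [simp]: "norm (c *\<^sub>C x) = cmod c * norm (x::'a::complex_hilbert_space)"
proof -
  have "complex_of_real ((norm (c *\<^sub>C x))\<^sup>2) = (c * cnj c) * cinner x x"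
    by (simp only: cinner_self[symmetric] cinner_scaleC_left cinner_scaleC_right mult.assoc mult.left_commute)
  also have "\<dots> = complex_of_real ((cmod c * norm x)\<^sup>2)"
    by (simp add: cinner_self complex_mult_cnj cmod_power2 power_mult_distrib)
  finally have "(norm (c *\<^sub>C x))\<^sup>2 = (cmod c * norm x)\<^sup>2"
    using of_real_eq_iff by blast
  then show ?thesis by simp
qed

lemma power2_norm_diff:
  "(norm (x - y))\<^sup>2 = (norm x)\<^sup>2 + (norm y)\<^sup>2 - 2 * Re (cinner x (y::'a::complex_hilbert_space))"
proof -
  have "cinner (x - y) (x - y) = cinner x x + cinner y y - (cinner x y + cnj (cinner x y))"
    by (simp add: cinner_diff_left cinner_diff_right cinner_commute[of y x])
  then have "Re (cinner (x - y) (x - y)) = Re (cinner x x + cinner y y - (cinner x y + cnj (cinner x y)))"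
    by simp
  then show ?thesis by (simp add: cinner_self)
qed

lemma parallelogram:
  "(norm (x - y))\<^sup>2 + (norm (x + y))\<^sup>2 = 2 * (norm x)\<^sup>2 + 2 * (norm (y::'a::complex_hilbert_space))\<^sup>2"
  using power2_norm_diff[of x y] power2_norm_diff[of x "- y"] cinner_diff_right[of x 0 y]
  by simp

text \<open>Pythagoras for the component of \<open>w\<close> orthogonal to \<open>z\<close>.
  Nonnegativity of the left side is Cauchy-Schwarz; minimality of a nearest point forces the
  subtracted term to vanish.\<close>

lemma power2_norm_diff_projection:
  fixes w z :: "'a::complex_hilbert_space"
  assumes "z \<noteq> 0"
  shows "(norm (w - (cinner w z / (norm z)\<^sup>2) *\<^sub>C z))\<^sup>2 = (norm w)\<^sup>2 - (cmod (cinner w z))\<^sup>2 / (norm z)\<^sup>2"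
proof -
  let ?c = "cinner w z"
  have "cinner w ((?c / (norm z)\<^sup>2) *\<^sub>C z) = complex_of_real ((cmod ?c)\<^sup>2 / (norm z)\<^sup>2)"
    by (simp add: cinner_scaleC_right complex_mult_cnj cmod_power2 mult.commute[of "cnj ?c"])
  moreover have "(norm ((?c / (norm z)\<^sup>2) *\<^sub>C z))\<^sup>2 = (cmod ?c)\<^sup>2 / (norm z)\<^sup>2"
    using assms
    by (simp add: norm_divide norm_mult power_mult_distrib power_divide field_simps power2_eq_square)
  ultimately show ?thesis by (simp add: power2_norm_diff)
qed

lemma norm_cinner_le: "cmod (cinner x y) \<le> norm x * norm (y::'a::complex_hilbert_space)"
proof (cases "y = 0")
  case False
  have "0 \<le> (norm x)\<^sup>2 - (cmod (cinner x y))\<^sup>2 / (norm y)\<^sup>2"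
    using power2_norm_diff_projection[OF False, of x] by (metis zero_le_power2)
  then have "(cmod (cinner x y))\<^sup>2 \<le> (norm x * norm y)\<^sup>2"
    using False by (simp add: field_simps power_mult_distrib)
  then show ?thesis by (rule power2_le_imp_le) simp
qed simp

lemma bounded_linear_cinner_right: "bounded_linear (\<lambda>y. cinner x (y::'a::complex_hilbert_space))"
  by (rule bounded_linear_intro[where K = "norm x"])
    (simp_all add: cinner_add_right cinner_scaleR_right scaleR_conv_of_real norm_cinner_le
      mult.commute[of _ "norm x"])

text \<open>Trades a norm bound for a family of conditions on inner products, each continuous in
  \<open>x\<close>; this makes the sets in the Hellinger-Toeplitz argument closed.\<close>

lemma norm_le_iff_cinner_bound:
  fixes x :: "'a::complex_hilbert_space"
  assumes "0 \<le> b"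
  shows "norm x \<le> b \<longleftrightarrow> (\<forall>y. cmod (cinner y x) \<le> b * norm y)"
proof
  assume "norm x \<le> b"
  then show "\<forall>y. cmod (cinner y x) \<le> b * norm y"
    using norm_cinner_le[of _ x] by (metis mult.commute mult_right_mono norm_ge_zero order_trans)
next
  assume "\<forall>y. cmod (cinner y x) \<le> b * norm y"
  then have "cmod (cinner x x) \<le> b * norm x" by blast
  then have "norm x * norm x \<le> b * norm x"
    by (simp add: cinner_self power2_eq_square norm_mult)
  then show "norm x \<le> b"
    using assms by (cases "x = 0") auto
qed

text \<open>The Hellinger-Toeplitz theorem; the symmetry of \<open>f\<close> yields its linearity as well.\<close>

lemma symmetric_imp_selfadjoint_op:
  fixes f :: "'a::complex_hilbert_space \<Rightarrow> 'a"
  assumes sym: "\<And>x y. cinner (f x) y = cinner x (f y)"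
  obtains A where "A \<in> selfadjoint_ops" "blinfun_apply A = f"
proof -
  have add: "f (x + y) = f x + f y" for x y
    by (rule cinner_ext) (simp add: sym cinner_add_left)
  have scaleC: "f (c *\<^sub>C x) = c *\<^sub>C f x" for c x
    by (rule cinner_ext) (simp add: sym cinner_scaleC_left)
  have scaleR: "f (r *\<^sub>R x) = r *\<^sub>R f x" for r x
    by (simp add: scaleC flip: scaleC_of_real)
  \<comment> \<open>Baire category argument. \<open>f\<close> is not yet known to be continuous, but
    symmetry turns the condition on \<open>f x\<close> into bounds on \<open>cinner (f y) x\<close>,
    which are closed conditions on \<open>x\<close>.\<close>
  define E where "E n = {x. norm (f x) \<le> real n}" for n
  have "closed (E n)" for n
  proof -
    have "E n = (\<Inter>y. {x. cmod (cinner (f y) x) \<le> real n * norm y})"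
      by (auto simp: E_def norm_le_iff_cinner_bound sym)
    moreover have "closed {x. cmod (cinner (f y) x) \<le> real n * norm y}" for y
      by (intro closed_Collect_le continuous_intros
          linear_continuous_on[OF bounded_linear_cinner_right])
    ultimately show ?thesis by auto
  qed
  moreover have "(\<Union>n. E n) = UNIV"
    using real_arch_simple by (auto simp: E_def)
  ultimately obtain n where "interior (E n) \<noteq> {}"
    using Baire_category_alt[of "euclidean :: 'a topology" "range E"]
    by (auto simp: completely_metrizable_space_euclidean)
  then obtain x0 r where r: "r > 0" "cball x0 r \<subseteq> E n"
    by (auto simp: mem_interior_cball)
  have bound: "norm (f x) \<le> norm x * (2 * n / r)" for x
  proof (cases "x = 0")
    case False
    \<comment> \<open>\<open>z\<close> is \<open>x\<close> rescaled to norm \<open>r\<close>, so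
      \<open>x0\<close> and \<open>x0 + z\<close> lie in the ball and \<open>f z\<close> is a
      difference of two vectors of norm at most \<open>n\<close>.\<close>
    define z where "z = (r / norm x) *\<^sub>R x"
    have "x0 \<in> E n" "x0 + z \<in> E n"
      using r False by (auto simp: z_def mem_cball dist_norm intro!: subsetD[OF r(2)])
    moreover have "f z = f (x0 + z) - f x0" by (simp add: add)
    ultimately have "norm (f z) \<le> 2 * n"
      using norm_triangle_ineq4[of "f (x0 + z)" "f x0"] by (simp add: E_def)
    then have "r / norm x * norm (f x) \<le> 2 * n"
      using r(1) by (simp add: z_def scaleR)
    then show ?thesis using r(1) False by (simp add: field_simps)
  qed (use scaleR[of 0 0] in simp)
  have "bounded_linear f"
    using add scaleR bound by (rule bounded_linear_intro)
  then have "blinfun_apply (Blinfun f) = f"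
    by (rule bounded_linear_Blinfun_apply)
  with that[of "Blinfun f"] show thesis
    by (simp add: selfadjoint_ops_def bounded_ops_def sym scaleC)
qed

section \<open>Orthogonal projections\<close>

text \<open>The sets \<open>S n\<close> of near-minimisers are nested and closed, with diameters
  tending to 0 by the parallelogram law; completeness gives a common point.\<close>

lemma ex_nearest_point:
  fixes M :: "'a::complex_hilbert_space set"
  assumes "closed M" "M \<noteq> {}"
    and mid: "\<And>y z. y \<in> M \<Longrightarrow> z \<in> M \<Longrightarrow> (1 / 2) *\<^sub>R (y + z) \<in> M"
  obtains p where "p \<in> M" "\<And>y. y \<in> M \<Longrightarrow> norm (x - p) \<le> norm (x - y)"
proof -
  define D where "D = (INF y\<in>M. (norm (x - y))\<^sup>2)"
  have D_le: "D \<le> (norm (x - y))\<^sup>2" if "y \<in> M" for y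
    unfolding D_def using that by (intro cINF_lower bdd_belowI2[where m = 0]) auto
  define S where "S n = {y \<in> M. (norm (x - y))\<^sup>2 \<le> D + 1 / real (Suc n)}" for n
  have "\<exists>p. \<forall>n. p \<in> S n"
  proof (rule decreasing_closed_nest[of S])
    fix n
    have "closed (M \<inter> {y. (norm (x - y))\<^sup>2 \<le> D + 1 / real (Suc n)})"
      by (intro closed_Int assms closed_Collect_le continuous_intros)
    then show "closed (S n)" by (simp add: S_def Int_def)
    have "\<exists>y\<in>M. (norm (x - y))\<^sup>2 < D + 1 / real (Suc n)"
      unfolding D_def using \<open>M \<noteq> {}\<close>
      by (subst cINF_less_iff[symmetric]) (auto intro: bdd_belowI2[where m = 0])
    then show "S n \<noteq> {}" by (force simp: S_def)
  next
    fix m n :: nat assume "m \<le> n"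
    then have "1 / real (Suc n) \<le> 1 / real (Suc m)" by (simp add: field_simps)
    then show "S n \<subseteq> S m" by (auto simp: S_def)
  next
    fix e :: real assume "e > 0"
    then obtain n where n: "4 / e\<^sup>2 < real n" using reals_Archimedean2 by blast
    have "dist y z < e" if "y \<in> S n" "z \<in> S n" for y z
    proof -
      \<comment> \<open>The midpoint of \<open>y\<close> and \<open>z\<close> has squared distance
        at least \<open>D\<close> from \<open>x\<close>, so the parallelogram law leaves at most
        \<open>4 * (D + 1 / Suc n) - 4 * D\<close> for the square of
        \<open>norm (y - z)\<close>.\<close>
      have "x - (1 / 2) *\<^sub>R (y + z) = (1 / 2) *\<^sub>R ((x - y) + (x - z))"
        by (simp add: algebra_simps flip: scaleR_add_left)
      then have "D \<le> (norm ((x - y) + (x - z)))\<^sup>2 / 4"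
        using D_le[OF mid[of y z]] that by (simp add: S_def power_divide)
      then have "(norm (y - z))\<^sup>2 \<le> 4 / real (Suc n)"
        using parallelogram[of "x - y" "x - z"] that by (simp add: S_def norm_minus_commute)
      also have "\<dots> < e\<^sup>2" using n \<open>e > 0\<close> by (simp add: field_simps add_strict_increasing)
      finally show ?thesis
        using \<open>e > 0\<close> by (simp add: dist_norm power_less_imp_less_base)
    qed
    then show "\<exists>n. \<forall>y\<in>S n. \<forall>z\<in>S n. dist y z < e" by blast
  next
    fix a assume "\<And>n. a \<in> S n"
    then show "\<exists>p. \<forall>n. p \<in> S n" by blast
  qed
  then obtain p where p: "\<And>n. p \<in> S n" by blast
  have "(norm (x - p))\<^sup>2 \<le> D"
  proof (rule field_le_epsilon)
    fix e :: real assume "e > 0"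
    then obtain n where "1 / real (Suc n) < e" using nat_approx_posE by blast
    with p[of n] show "(norm (x - p))\<^sup>2 \<le> D + e" by (simp add: S_def)
  qed
  show thesis
  proof
    show "p \<in> M" using p[of 0] by (simp add: S_def)
    show "norm (x - p) \<le> norm (x - y)" if "y \<in> M" for y
      using \<open>(norm (x - p))\<^sup>2 \<le> D\<close> D_le[OF that] by (auto intro: power2_le_imp_le[OF order_trans])
  qed
qed

definition csubspace :: "'a::complex_hilbert_space set \<Rightarrow> bool" where
  "csubspace M \<longleftrightarrow> 0 \<in> M \<and> (\<forall>x\<in>M. \<forall>y\<in>M. x + y \<in> M) \<and> (\<forall>c. \<forall>x\<in>M. c *\<^sub>C x \<in> M)"

lemma csubspace_scaleR: "csubspace M \<Longrightarrow> x \<in> M \<Longrightarrow> r *\<^sub>R x \<in> M"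
  unfolding csubspace_def by (metis scaleC_of_real)

lemma csubspace_diff: "csubspace M \<Longrightarrow> x \<in> M \<Longrightarrow> y \<in> M \<Longrightarrow> x - y \<in> M"
  unfolding csubspace_def by (metis diff_conv_add_uminus scaleC_minus_one)

text \<open>The nearest point works: if \<open>x - p\<close> had a component along some
  \<open>z\<close> in \<open>M\<close>, adding it to \<open>p\<close> would come strictly closer to
  \<open>x\<close>.\<close>

lemma ex_orthogonal_projection:
  fixes M :: "'a::complex_hilbert_space set"
  assumes M: "csubspace M" "closed M"
  obtains p where "p \<in> M" "\<And>z. z \<in> M \<Longrightarrow> cinner (x - p) z = 0"
proof -
  obtain p where p: "p \<in> M" "\<And>y. y \<in> M \<Longrightarrow> norm (x - p) \<le> norm (x - y)"
    using M by (elim ex_nearest_point[where x = x]) (auto simp: csubspace_def csubspace_scaleR)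
  have "cinner (x - p) z = 0" if "z \<in> M" for z
  proof (cases "z = 0")
    case False
    let ?t = "cinner (x - p) z / (norm z)\<^sup>2"
    have "p + ?t *\<^sub>C z \<in> M" using p(1) that M by (simp add: csubspace_def)
    from p(2)[OF this] have "(norm (x - p))\<^sup>2 \<le> (norm (x - p - ?t *\<^sub>C z))\<^sup>2"
      by (simp add: power_mono diff_diff_eq)
    then have "(cmod (cinner (x - p) z))\<^sup>2 / (norm z)\<^sup>2 \<le> 0"
      by (simp only: power2_norm_diff_projection[OF False])
    then show ?thesis using False by (simp add: divide_le_0_iff)
  qed simp
  with p(1) show thesis by (rule that)
qed

lemma orthogonal_projection_unique:
  fixes M :: "'a::complex_hilbert_space set"
  assumes "csubspace M" "p \<in> M" "q \<in> M"
    and "\<And>z. z \<in> M \<Longrightarrow> cinner (x - p) z = 0" "\<And>z. z \<in> M \<Longrightarrow> cinner (x - q) z = 0"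
  shows "p = q"
proof -
  have "q - p \<in> M" using assms by (simp add: csubspace_diff)
  then have "cinner (x - p) (q - p) - cinner (x - q) (q - p) = 0"
    using assms(4,5) by simp
  then show ?thesis by (simp flip: cinner_diff_left)
qed

lemma bounded_opsD: "A \<in> bounded_ops \<Longrightarrow> A (c *\<^sub>C x) = c *\<^sub>C A x"
  by (simp add: bounded_ops_def)

lemma bounded_ops_diff: "A \<in> bounded_ops \<Longrightarrow> B \<in> bounded_ops \<Longrightarrow> A - B \<in> bounded_ops"
  by (simp add: bounded_ops_def blinfun.diff_left scaleC_diff_right)

lemma selfadjoint_imp_bounded_ops: "A \<in> selfadjoint_ops \<Longrightarrow> A \<in> bounded_ops"
  by (simp add: selfadjoint_ops_def)

lemma selfadjointD: "A \<in> selfadjoint_ops \<Longrightarrow> cinner (A x) y = cinner x (A y)"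
  by (simp add: selfadjoint_ops_def)

lemma selfadjoint_diff: "A \<in> selfadjoint_ops \<Longrightarrow> B \<in> selfadjoint_ops \<Longrightarrow> A - B \<in> selfadjoint_ops"
  by (simp add: selfadjoint_ops_def bounded_ops_diff blinfun.diff_left cinner_diff_left cinner_diff_right)

text \<open>Moving \<open>A\<close> across the inner product turns \<open>A x = 0\<close> into
  orthogonality, so questions about nullspaces reduce to questions about ranges.\<close>

lemma selfadjoint_orthogonal_range:
  assumes "A \<in> selfadjoint_ops"
  shows "A x = 0 \<longleftrightarrow> (\<forall>y\<in>range A. cinner x y = 0)"
proof -
  have "A x = 0 \<longleftrightarrow> (\<forall>y. cinner (A x) y = 0)"
    by (metis cinner_self_eq_zero cinner_zero_left)
  then show ?thesis by (simp add: selfadjointD[OF assms])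
qed

lemma csubspace_range: "A \<in> bounded_ops \<Longrightarrow> csubspace (range A)"
  unfolding csubspace_def
  by (auto simp: image_iff simp flip: blinfun.add_right bounded_opsD intro: exI[of _ 0])

text \<open>Replaces the definite description by usable properties. The pointwise projections form a
  symmetric map because residuals are orthogonal to the range; Hellinger-Toeplitz makes it a bounded
  operator.\<close>

lemma is_range_proj:
  fixes A :: "'a::complex_hilbert_space \<Rightarrow>\<^sub>L 'a"
  assumes A: "A \<in> bounded_ops" "closed (range A)"
  shows "range_proj A \<in> selfadjoint_ops"
    and "range_proj A x \<in> range A"
    and "z \<in> range A \<Longrightarrow> cinner (x - range_proj A x) z = 0"
proof -
  let ?M = "range A"
  let ?proj = "\<lambda>P x. P x \<in> ?M \<and> (\<forall>z\<in>?M. cinner (x - P x) z = 0)"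
  have "\<forall>x. \<exists>p. p \<in> ?M \<and> (\<forall>z\<in>?M. cinner (x - p) z = 0)"
    using ex_orthogonal_projection[OF csubspace_range[OF A(1)] A(2)] by metis
  then obtain p where p: "\<And>x. ?proj p x" by metis
  have "cinner (p x) y = cinner x (p y)" for x y
  proof -
    have "cinner (x - p x) (p y) = 0" "cinner (p x) (y - p y) = 0"
      using p cinner_eq_zero_swap by blast+
    then show ?thesis by (simp add: cinner_diff_left cinner_diff_right)
  qed
  then obtain P where P: "P \<in> selfadjoint_ops" "blinfun_apply P = p"
    by (rule symmetric_imp_selfadjoint_op)
  have unique: "Q = P" if Q: "\<And>x. ?proj (blinfun_apply Q) x" for Q :: "'a \<Rightarrow>\<^sub>L 'a"
    by (rule blinfun_eqI, rule orthogonal_projection_unique[OF csubspace_range[OF A(1)]])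
      (use Q P p in blast)+
  have "range_proj A = P"
    unfolding range_proj_def closure_closed[OF A(2)]
    by (rule the_equality) (use P p unique selfadjoint_imp_bounded_ops in auto)
  with P p show "range_proj A \<in> selfadjoint_ops" "range_proj A x \<in> range A"
    "z \<in> range A \<Longrightarrow> cinner (x - range_proj A x) z = 0" by auto
qed

lemma range_proj_eqI:
  assumes A: "A \<in> bounded_ops" "closed (range A)"
    and p: "p \<in> range A" "\<And>z. z \<in> range A \<Longrightarrow> cinner (x - p) z = 0"
  shows "range_proj A x = p"
  using orthogonal_projection_unique[OF csubspace_range[OF A(1)] is_range_proj(2)[OF A] p(1)]
    is_range_proj(3)[OF A] p(2) by blast

lemma range_proj_fixes:
  assumes "A \<in> bounded_ops" "closed (range A)" "y \<in> range A"
  shows "range_proj A y = y"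
  using assms by (intro range_proj_eqI) auto

lemma range_range_proj:
  assumes "A \<in> bounded_ops" "closed (range A)"
  shows "range (range_proj A) = range A"
  using is_range_proj(2)[OF assms] range_proj_fixes[OF assms, symmetric]
  by (metis image_subset_iff rangeI subsetI subset_antisym)

lemma selfadjoint_range_proj:
  assumes A: "A \<in> selfadjoint_ops" "closed (range A)"
  shows "A (range_proj A x) = A x"
proof -
  note P = is_range_proj[OF selfadjoint_imp_bounded_ops[OF A(1)] A(2)]
  have "A (x - range_proj A x) = 0"
    using P(3) by (simp add: selfadjoint_orthogonal_range[OF A(1)])
  then show ?thesis by (simp add: blinfun.diff_right)
qed

text \<open>Both nullspaces are the orthogonal complement of the same range.\<close>

lemma nullspace_range_proj:
  assumes A: "A \<in> selfadjoint_ops" "closed (range A)"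
  shows "nullspace (range_proj A) = nullspace A"
proof -
  have A': "A \<in> bounded_ops" by (rule selfadjoint_imp_bounded_ops[OF A(1)])
  show ?thesis
    by (simp add: nullspace_def selfadjoint_orthogonal_range[OF A(1)] range_range_proj[OF A' A(2)]
        selfadjoint_orthogonal_range[OF is_range_proj(1)[OF A' A(2)]])
qed

section \<open>The Moore-Penrose inverse of a selfadjoint operator\<close>

text \<open>\<open>U\<close> maps its range bijectively onto itself, and \<open>X\<close> inverts
  this restriction after projecting onto the range. The last equation records that \<open>X\<close>
  takes values in the range, whence \<open>X o\<^sub>L U o\<^sub>L X = X\<close>.\<close>

lemma ex_penrose:
  fixes U :: "'a::complex_hilbert_space \<Rightarrow>\<^sub>L 'a"
  assumes U: "U \<in> selfadjoint_ops" "closed (range U)"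
  obtains X where "X \<in> selfadjoint_ops" "U o\<^sub>L X = range_proj U" "X o\<^sub>L U = range_proj U"
    "range_proj U o\<^sub>L X = X"
proof -
  have U': "U \<in> bounded_ops" by (rule selfadjoint_imp_bounded_ops[OF U(1)])
  let ?P = "range_proj U"
  note P = is_range_proj[OF U' U(2)]
  have PP: "?P y = y" if "y \<in> range U" for y
    using that by (rule range_proj_fixes[OF U' U(2)])
  have inj: "x = y" if "x \<in> range U" "y \<in> range U" "U x = U y" for x y
  proof -
    have "x - y \<in> range U" using that by (simp add: csubspace_diff csubspace_range U')
    moreover have "U (x - y) = 0" using that by (simp add: blinfun.diff_right)
    ultimately have "cinner (x - y) (x - y) = 0"
      using selfadjoint_orthogonal_range[OF U(1)] by blast
    then show ?thesis by simp
  qed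
  \<comment> \<open>\<open>?P y\<close> is \<open>U v\<close> for some \<open>v\<close>, and
    \<open>?P v\<close> is then a preimage inside the range.\<close>
  have "\<forall>y. \<exists>x. x \<in> range U \<and> U x = ?P y"
    using P(2) selfadjoint_range_proj[OF U] by (metis image_iff)
  then obtain f where f: "\<And>y. f y \<in> range U" "\<And>y. U (f y) = ?P y" by metis
  have "cinner (f y) w = cinner y (f w)" for y w
  proof -
    have "cinner (f y) w = cinner (?P (f y)) w" by (simp add: PP f)
    also have "\<dots> = cinner (f y) (U (f w))" by (simp only: selfadjointD[OF P(1)] f)
    also have "\<dots> = cinner (U (f y)) (f w)" by (simp only: selfadjointD[OF U(1)])
    also have "\<dots> = cinner y (?P (f w))" by (simp only: f selfadjointD[OF P(1)])
    finally show ?thesis by (simp add: PP f)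
  qed
  then obtain X where X: "X \<in> selfadjoint_ops" "blinfun_apply X = f"
    by (rule symmetric_imp_selfadjoint_op)
  show thesis
  proof (rule that[OF X(1)]; rule blinfun_eqI)
    fix x
    show "(U o\<^sub>L X) x = ?P x" by (simp add: X f)
    \<comment> \<open>Both sides lie in the range and \<open>U\<close> sends both to
      \<open>U x\<close>, so injectivity on the range applies.\<close>
    show "(X o\<^sub>L U) x = ?P x"
      by (auto simp: X f P PP selfadjoint_range_proj[OF U] intro: inj)
    show "(?P o\<^sub>L X) x = X x"
      by (simp add: X f PP)
  qed
qed

lemma blinfun_compose_assoc: "(A o\<^sub>L B) o\<^sub>L C = A o\<^sub>L (B o\<^sub>L C)"
  by (rule blinfun_eqI) simp

text \<open>The adjoint of the product is the product in reverse order.\<close>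

lemma selfadjoint_compose_commute:
  assumes "A \<in> selfadjoint_ops" "B \<in> selfadjoint_ops" "A o\<^sub>L B \<in> selfadjoint_ops"
  shows "A o\<^sub>L B = B o\<^sub>L A"
proof (rule blinfun_eqI, rule cinner_ext)
  fix x z
  have "cinner ((A o\<^sub>L B) x) z = cinner x (A (B z))"
    using selfadjointD[OF assms(3)] by simp
  also have "\<dots> = cinner (B (A x)) z"
    by (simp only: selfadjointD[OF assms(1)] selfadjointD[OF assms(2)])
  finally show "cinner ((A o\<^sub>L B) x) z = cinner ((B o\<^sub>L A) x) z" by simp
qed

text \<open>The selfadjoint idempotents \<open>U X\<close> and \<open>U Y\<close> absorb each other,
  so they coincide once they commute; likewise \<open>X U\<close> and \<open>Y U\<close>. Then
  \<open>X = X U X = X U Y = Y U Y = Y\<close>.\<close>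

lemma penrose_unique:
  assumes X: "U o\<^sub>L X o\<^sub>L U = U" "X o\<^sub>L U o\<^sub>L X = X"
      "U o\<^sub>L X \<in> selfadjoint_ops" "X o\<^sub>L U \<in> selfadjoint_ops"
    and Y: "U o\<^sub>L Y o\<^sub>L U = U" "Y o\<^sub>L U o\<^sub>L Y = Y"
      "U o\<^sub>L Y \<in> selfadjoint_ops" "Y o\<^sub>L U \<in> selfadjoint_ops"
  shows "X = Y"
proof -
  have "(U o\<^sub>L X) o\<^sub>L (U o\<^sub>L Y) = U o\<^sub>L Y" "(U o\<^sub>L Y) o\<^sub>L (U o\<^sub>L X) = U o\<^sub>L X"
    using X(1) Y(1) by (simp_all flip: blinfun_compose_assoc)
  then have UX: "U o\<^sub>L X = U o\<^sub>L Y"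
    using selfadjoint_compose_commute[OF X(3) Y(3)] Y(3) by simp
  have "(X o\<^sub>L U) o\<^sub>L (Y o\<^sub>L U) = X o\<^sub>L U" "(Y o\<^sub>L U) o\<^sub>L (X o\<^sub>L U) = Y o\<^sub>L U"
    using X(1) Y(1) by (simp_all add: blinfun_compose_assoc)
  then have XU: "X o\<^sub>L U = Y o\<^sub>L U"
    using selfadjoint_compose_commute[OF X(4) Y(4)] X(4) by simp
  have "X = X o\<^sub>L (U o\<^sub>L X)" using X(2) by (simp add: blinfun_compose_assoc)
  also have "\<dots> = (X o\<^sub>L U) o\<^sub>L Y" by (simp add: UX blinfun_compose_assoc)
  also have "\<dots> = Y" by (simp add: XU Y(2))
  finally show ?thesis .
qed

lemma mp_inverse_comp_self:
  assumes U: "U \<in> selfadjoint_ops" "closed (range U)"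
  shows "mp_inverse U o\<^sub>L U = range_proj U"
proof -
  have U': "U \<in> bounded_ops" by (rule selfadjoint_imp_bounded_ops[OF U(1)])
  obtain X where X: "X \<in> selfadjoint_ops" "U o\<^sub>L X = range_proj U" "X o\<^sub>L U = range_proj U"
    "range_proj U o\<^sub>L X = X"
    using ex_penrose[OF U] by blast
  note P = is_range_proj(1)[OF U' U(2)]
  have PU: "range_proj U o\<^sub>L U = U"
    by (rule blinfun_eqI) (simp add: range_proj_fixes[OF U' U(2)])
  have "mp_inverse U = X"
    unfolding mp_inverse_def
  proof (rule the_equality)
    show "X \<in> bounded_ops \<and> U o\<^sub>L X o\<^sub>L U = U \<and> X o\<^sub>L U o\<^sub>L X = X \<and>
        U o\<^sub>L X \<in> selfadjoint_ops \<and> X o\<^sub>L U \<in> selfadjoint_ops"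
      using X P PU by (simp add: selfadjoint_imp_bounded_ops)
    then show "Y = X" if "Y \<in> bounded_ops \<and> U o\<^sub>L Y o\<^sub>L U = U \<and> Y o\<^sub>L U o\<^sub>L Y = Y \<and>
        U o\<^sub>L Y \<in> selfadjoint_ops \<and> Y o\<^sub>L U \<in> selfadjoint_ops" for Y
      using penrose_unique[of U Y X] that by simp
  qed
  then show ?thesis using X by simp
qed

section \<open>The spectral radius of a selfadjoint operator\<close>

text \<open>If \<open>cmod c > norm A\<close>, then \<open>c - A\<close> is bounded below by
  \<open>cmod c - norm A\<close>, which gives injectivity and bounds the inverse; surjectivity is
  Banach's fixed point theorem.\<close>

lemma op_spectrum_bound:
  fixes A :: "'a::complex_hilbert_space \<Rightarrow>\<^sub>L 'a"
  assumes A: "A \<in> bounded_ops" and c: "c \<in> op_spectrum A"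
  shows "cmod c \<le> norm A"
proof (rule ccontr)
  assume "\<not> cmod c \<le> norm A"
  then have gap: "norm A < cmod c" by simp
  then have c0: "c \<noteq> 0" and pos: "cmod c > 0" by (auto simp: not_less intro: le_less_trans[OF norm_ge_zero])
  have below: "(cmod c - norm A) * norm x \<le> norm (c *\<^sub>C x - A x)" for x
    using norm_triangle_ineq2[of "c *\<^sub>C x" "A x"] norm_blinfun[of A x] by (simp add: algebra_simps)
  have inj: "x = y" if "c *\<^sub>C x - A x = c *\<^sub>C y - A y" for x y
  proof -
    have "c *\<^sub>C (x - y) - A (x - y) = 0"
      using that by (simp add: scaleC_diff_right blinfun.diff_right algebra_simps)
    then have "(cmod c - norm A) * norm (x - y) \<le> 0" using below[of "x - y"] by simp
    then show ?thesis using gap by (simp add: mult_le_0_iff)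
  qed
  have "\<exists>x. c *\<^sub>C x - A x = y" for y
  proof -
    \<comment> \<open>Fixed points of \<open>?g\<close> are the solutions of the equation, and
      \<open>?g\<close> contracts by the factor \<open>norm A / cmod c\<close>.\<close>
    let ?g = "\<lambda>x. inverse c *\<^sub>C (y + A x)"
    have "dist (?g x) (?g x') \<le> norm A / cmod c * dist x x'" for x x'
    proof -
      have "?g x - ?g x' = inverse c *\<^sub>C A (x - x')"
        by (simp add: blinfun.diff_right flip: scaleC_diff_right)
      then have "cmod c * dist (?g x) (?g x') = norm (A (x - x'))"
        using pos by (simp add: dist_norm norm_inverse)
      then show ?thesis
        using norm_blinfun[of A "x - x'"] pos by (simp add: dist_norm field_simps)
    qed
    then have "\<exists>!x. ?g x = x"
      using gap pos by (intro banach_fix_type[of "norm A / cmod c"]) auto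
    then obtain x where "?g x = x" by blast
    then have "c *\<^sub>C x = y + A x"
      using c0 by (metis scaleC_scaleC scaleC_one right_inverse)
    then have "c *\<^sub>C x - A x = y" by simp
    then show ?thesis by blast
  qed
  then obtain f where f: "\<And>y. c *\<^sub>C f y - A (f y) = y" by metis
  have "f (x + y) = f x + f y" for x y
  proof (rule inj)
    have "c *\<^sub>C (f x + f y) - A (f x + f y) = (c *\<^sub>C f x - A (f x)) + (c *\<^sub>C f y - A (f y))"
      by (simp add: blinfun.add_right scaleC_add_right)
    then show "c *\<^sub>C f (x + y) - A (f (x + y)) = c *\<^sub>C (f x + f y) - A (f x + f y)"
      by (simp add: f)
  qed
  moreover have fC: "f (d *\<^sub>C x) = d *\<^sub>C f x" for d x
  proof (rule inj)
    have "c *\<^sub>C (d *\<^sub>C f x) - A (d *\<^sub>C f x) = d *\<^sub>C (c *\<^sub>C f x - A (f x))"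
      by (simp add: bounded_opsD[OF A] scaleC_diff_right scaleC_scaleC mult.commute)
    then show "c *\<^sub>C f (d *\<^sub>C x) - A (f (d *\<^sub>C x)) = c *\<^sub>C (d *\<^sub>C f x) - A (d *\<^sub>C f x)"
      by (simp add: f)
  qed
  moreover have "f (r *\<^sub>R x) = r *\<^sub>R f x" for r x
    by (simp add: fC flip: scaleC_of_real)
  moreover have "norm (f x) \<le> norm x * (1 / (cmod c - norm A))" for x
    using below[of "f x"] gap by (simp add: f field_simps)
  ultimately have "bounded_linear f" by (intro bounded_linear_intro)
  then have "blinfun_apply (Blinfun f) = f" by (rule bounded_linear_Blinfun_apply)
  moreover have "f (c *\<^sub>C x - A x) = x" for x by (rule inj) (rule f)
  ultimately have "Blinfun f \<in> bounded_ops \<and> (\<forall>x. Blinfun f (c *\<^sub>C x - A x) = x \<and>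
      c *\<^sub>C Blinfun f x - A (Blinfun f x) = x)"
    by (simp add: bounded_ops_def fC f)
  with c show False unfolding op_spectrum_def by blast
qed

text \<open>For unit vectors with \<open>\<parallel>A x\<parallel>\<close> close to \<open>m = \<parallel>A\<parallel>\<close> the vector \<open>(m\<^sup>2 - A\<^sup>2) x\<close> is small, so
  \<open>m\<^sup>2 - A\<^sup>2 = (m - A) (m + A)\<close> is not bounded below.\<close>

lemma selfadjoint_norm_in_spectrum:
  fixes A :: "'a::complex_hilbert_space \<Rightarrow>\<^sub>L 'a"
  assumes A: "A \<in> selfadjoint_ops" and "A \<noteq> 0"
  shows "complex_of_real (norm A) \<in> op_spectrum A \<or> complex_of_real (- norm A) \<in> op_spectrum A"
proof (rule ccontr)
  let ?m = "norm A"
  assume "\<not> ?thesis"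
  \<comment> \<open>Left inverses of \<open>m - A\<close> and \<open>- m - A\<close> make their
    product bounded below; this will sharpen the bound \<open>norm A\<close> to a strictly smaller
    one.\<close>
  then obtain B C :: "'a \<Rightarrow>\<^sub>L 'a" where B: "\<And>x. B (complex_of_real ?m *\<^sub>C x - A x) = x"
    and C: "\<And>x. C (complex_of_real (- ?m) *\<^sub>C x - A x) = x"
    unfolding op_spectrum_def by blast
  have m: "?m > 0" using \<open>A \<noteq> 0\<close> by simp
  \<comment> \<open>The summand 1 secures positivity, so that dividing by \<open>K\<close> is
    safe.\<close>
  define K where "K = norm C * norm B + 1"
  have K: "K > 0" by (simp add: K_def add_nonneg_pos)
  have below: "norm x \<le> K * norm (A (A x) - ?m\<^sup>2 *\<^sub>R x)" for x
  proof -
    let ?y = "complex_of_real (- ?m) *\<^sub>C x - A x"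
    have "complex_of_real ?m *\<^sub>C ?y - A ?y = A (A x) - ?m\<^sup>2 *\<^sub>R x"
      unfolding scaleC_of_real
      by (simp add: blinfun.diff_right blinfun.scaleR_right blinfun.minus_right algebra_simps power2_eq_square)
    then have "C (B (A (A x) - ?m\<^sup>2 *\<^sub>R x)) = x" using B[of ?y] C[of x] by simp
    then have "norm x \<le> norm C * norm (B (A (A x) - ?m\<^sup>2 *\<^sub>R x))"
      using norm_blinfun[of C "B (A (A x) - ?m\<^sup>2 *\<^sub>R x)"] by simp
    also have "\<dots> \<le> norm C * (norm B * norm (A (A x) - ?m\<^sup>2 *\<^sub>R x))"
      by (intro mult_left_mono norm_blinfun norm_ge_zero)
    also have "\<dots> \<le> K * norm (A (A x) - ?m\<^sup>2 *\<^sub>R x)"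
      by (simp add: K_def algebra_simps)
    finally show ?thesis .
  qed
  \<comment> \<open>Bounding \<open>norm x\<close> through \<open>below\<close> and expanding the
    square gives an inequality between the squares of \<open>norm x\<close> and
    \<open>norm (A x)\<close>; \<open>q\<close> is the constant obtained by solving it for the
    latter.\<close>
  define q where "q = ?m\<^sup>2 - 1 / (?m\<^sup>2 * K\<^sup>2)"
  have "(norm (A x))\<^sup>2 \<le> q * (norm x)\<^sup>2" for x
  proof -
    have AA: "norm (A (A x)) \<le> ?m * norm (A x)" by (rule norm_blinfun)
    have "Re (cinner (A (A x)) (?m\<^sup>2 *\<^sub>R x)) = ?m\<^sup>2 * (norm (A x))\<^sup>2"
      by (simp add: cinner_scaleR_right selfadjointD[OF A, of "A x"] cinner_self)
    then have "(norm (A (A x) - ?m\<^sup>2 *\<^sub>R x))\<^sup>2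
        = (norm (A (A x)))\<^sup>2 + (?m\<^sup>2 * norm x)\<^sup>2 - 2 * ?m\<^sup>2 * (norm (A x))\<^sup>2"
      by (simp add: power2_norm_diff)
    also have "\<dots> \<le> (?m * norm (A x))\<^sup>2 + (?m\<^sup>2 * norm x)\<^sup>2 - 2 * ?m\<^sup>2 * (norm (A x))\<^sup>2"
      using power_mono[OF AA, of 2] by simp
    also have "\<dots> = ?m\<^sup>2 * (?m\<^sup>2 * (norm x)\<^sup>2 - (norm (A x))\<^sup>2)"
      by (simp add: power_mult_distrib power2_eq_square algebra_simps)
    finally have upper: "(norm (A (A x) - ?m\<^sup>2 *\<^sub>R x))\<^sup>2 \<le> ?m\<^sup>2 * (?m\<^sup>2 * (norm x)\<^sup>2 - (norm (A x))\<^sup>2)" .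
    have "(norm x)\<^sup>2 \<le> K\<^sup>2 * (norm (A (A x) - ?m\<^sup>2 *\<^sub>R x))\<^sup>2"
      using power_mono[OF below[of x], of 2] by (simp add: power_mult_distrib)
    also have "\<dots> \<le> K\<^sup>2 * (?m\<^sup>2 * (?m\<^sup>2 * (norm x)\<^sup>2 - (norm (A x))\<^sup>2))"
      using upper by (rule mult_left_mono) simp
    finally show ?thesis
      using m K by (simp add: q_def field_simps)
  qed
  then have bound: "norm (A x) \<le> sqrt q * norm x" for x
    by (metis norm_ge_zero real_sqrt_abs real_sqrt_le_mono real_sqrt_mult abs_of_nonneg)
  \<comment> \<open>\<open>sqrt\<close> is an odd function on the reals, so its sign is settled by a
    vector with \<open>A x\<close> nonzero.\<close>
  have "0 \<le> sqrt q"
  proof -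
    obtain x where "A x \<noteq> 0" using \<open>A \<noteq> 0\<close> by (metis blinfun_eqI zero_blinfun.rep_eq)
    then have "0 < sqrt q * norm x" using bound[of x] by (metis less_le_trans zero_less_norm_iff)
    then show ?thesis by (metis norm_ge_zero zero_less_mult_iff less_imp_le not_le)
  qed
  then have "?m \<le> sqrt q" using bound by (rule norm_blinfun_bound)
  then have "?m\<^sup>2 \<le> q" using \<open>0 \<le> sqrt q\<close> m
    by (metis power_mono real_sqrt_ge_0_iff real_sqrt_pow2 less_imp_le)
  moreover have "0 < 1 / (?m\<^sup>2 * K\<^sup>2)" using m K by simp
  ultimately show False by (simp add: q_def)
qed

text \<open>The supremum is attained at a spectral point \<open>norm A\<close> or
  \<open>- norm A\<close>; for \<open>A = 0\<close> the inserted 0 attains it.\<close>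

lemma op_spectral_radius_selfadjoint:
  assumes A: "A \<in> selfadjoint_ops"
  shows "op_spectral_radius A = norm A"
  unfolding op_spectral_radius_def
proof (rule cSup_eq_maximum)
  show "norm A \<in> insert 0 (cmod ` op_spectrum A)"
  proof (cases "A = 0")
    case False
    then show ?thesis
      using selfadjoint_norm_in_spectrum[OF A] by (force simp: image_iff)
  qed simp
  show "r \<le> norm A" if "r \<in> insert 0 (cmod ` op_spectrum A)" for r
    using that op_spectrum_bound[OF selfadjoint_imp_bounded_ops[OF A]] by auto
qed

section \<open>Splittings\<close>

lemma splitting_converges_iff:
  assumes U: "U \<in> selfadjoint_ops" "closed (range U)"
    and W: "W \<in> selfadjoint_ops" "range W \<subseteq> range U"
  shows "splitting_converges U (U o\<^sub>L W) \<longleftrightarrow> norm W < 1"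
proof -
  have "mp_inverse U o\<^sub>L (U o\<^sub>L W) = range_proj U o\<^sub>L W"
    by (simp add: mp_inverse_comp_self[OF U] flip: blinfun_compose_assoc)
  also have "\<dots> = W"
  proof (rule blinfun_eqI)
    fix x
    have "W x \<in> range U" using W(2) by blast
    then show "(range_proj U o\<^sub>L W) x = W x"
      by (simp only: blinfun_apply_blinfun_compose
          range_proj_fixes[OF selfadjoint_imp_bounded_ops[OF U(1)] U(2)])
  qed
  finally show ?thesis
    by (simp add: splitting_converges_def op_spectral_radius_selfadjoint[OF W(1)])
qed

text \<open>Orthogonality makes each operator vanish on the range of the other. The right-hand sides
  depend only on the ranges and nullspaces of \<open>A\<close> and \<open>B\<close>, so either may
  be replaced by its range projection.\<close>

lemma orthogonal_ranges_diff:
  assumes A: "A \<in> selfadjoint_ops" "closed (range A)"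
    and B: "B \<in> selfadjoint_ops" "closed (range B)"
    and orth: "\<And>x y. x \<in> range A \<Longrightarrow> y \<in> range B \<Longrightarrow> cinner x y = 0"
  shows "range (A - B) = {x + y | x y. x \<in> range A \<and> y \<in> range B}"
    and "nullspace (A - B) = nullspace A \<inter> nullspace B"
proof -
  note PA = is_range_proj[OF selfadjoint_imp_bounded_ops[OF A(1)] A(2)]
  note PB = is_range_proj[OF selfadjoint_imp_bounded_ops[OF B(1)] B(2)]
  have AB: "A y = 0" if "y \<in> range B" for y
    unfolding selfadjoint_orthogonal_range[OF A(1)] using orth that cinner_eq_zero_swap by blast
  have BA: "B x = 0" if "x \<in> range A" for x
    unfolding selfadjoint_orthogonal_range[OF B(1)] using orth that by blast
  have "\<exists>z. A x + B y = (A - B) z" for x y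
  proof
    \<comment> \<open>On this preimage the cross terms vanish, and the minus sign of
      \<open>range_proj B y\<close> cancels that of \<open>A - B\<close>.\<close>
    show "A x + B y = (A - B) (range_proj A x - range_proj B y)"
      by (simp add: blinfun.diff_left blinfun.diff_right selfadjoint_range_proj[OF A]
          selfadjoint_range_proj[OF B] AB[OF PB(2)] BA[OF PA(2)])
  qed
  then have "{x + y | x y. x \<in> range A \<and> y \<in> range B} \<subseteq> range (A - B)" by blast
  moreover have "(A - B) z = A z + B (- z)" for z
    by (simp add: blinfun.diff_left blinfun.minus_right)
  then have "range (A - B) \<subseteq> {x + y | x y. x \<in> range A \<and> y \<in> range B}" by blast
  ultimately show "range (A - B) = {x + y | x y. x \<in> range A \<and> y \<in> range B}" by blast
  \<comment> \<open>The common value lies in both ranges and is therefore orthogonal to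
    itself.\<close>
  have "A x = 0 \<and> B x = 0" if "A x = B x" for x
    using orth[OF rangeI rangeI, of x x] that by simp
  then show "nullspace (A - B) = nullspace A \<inter> nullspace B"
    by (auto simp: nullspace_def blinfun.diff_left)
qed

text \<open>Writing \<open>a + b = T1 z - T2 z\<close> makes \<open>a - T1 z\<close> the negative of
  \<open>b + T2 z\<close>; the two are orthogonal, hence zero. Taking \<open>b = 0\<close> or
  \<open>a = 0\<close> shows that every point of either closure is attained.\<close>

lemma positive_orthogonal_decomposition_closed_ranges:
  fixes T T1 T2 :: "'a::complex_hilbert_space \<Rightarrow>\<^sub>L 'a"
  assumes T: "closed (range T)" and dec: "positive_orthogonal_decomposition T T1 T2"
  shows "closed (range T1)" "closed (range T2)"
proof -
  let ?M1 = "closure (range T1)" and ?M2 = "closure (range T2)"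
  have T12: "T = T1 - T2"
    and orth: "\<And>x y. x \<in> ?M1 \<Longrightarrow> y \<in> ?M2 \<Longrightarrow> cinner x y = 0"
    and sum: "{x + y | x y. x \<in> ?M1 \<and> y \<in> ?M2} = range T"
    using dec T by (auto simp: positive_orthogonal_decomposition_def)
  have mem: "T1 z \<in> ?M1" "T2 z \<in> ?M2" for z
    by (simp_all add: closure_subset[THEN subsetD])
  have zero: "0 \<in> ?M1" "0 \<in> ?M2"
    using mem[of 0] by auto
  have split: "\<exists>z. a = T1 z \<and> b = - T2 z" if "a \<in> ?M1" "b \<in> ?M2" for a b
  proof -
    have "a + b \<in> range T" using that unfolding sum[symmetric] by blast
    then obtain z where "a + b = T z" by blast
    then have eq: "b + T2 z = - (a - T1 z)"
      by (simp add: T12 blinfun.diff_left algebra_simps)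
    have "cinner (a - T1 z) (b + T2 z) = 0"
      using that mem by (simp add: cinner_diff_left cinner_add_right orth)
    then have "cinner (a - T1 z) (a - T1 z) = 0"
      using cinner_diff_right[of "a - T1 z" 0 "a - T1 z"] by (simp only: eq) simp
    then have "a - T1 z = 0" by (simp only: cinner_self_eq_zero)
    with eq show ?thesis by (auto simp: eq_neg_iff_add_eq_0)
  qed
  have "?M1 \<subseteq> range T1" using split[OF _ zero(2)] by blast
  then show "closed (range T1)" by (metis closure_subset_eq)
  have "?M2 \<subseteq> range T2"
    using split[OF zero(1)] by (metis blinfun.minus_right rangeI subsetI)
  then show "closed (range T2)" by (metis closure_subset_eq)
qed

lemma
  fixes A B :: "'a::complex_hilbert_space \<Rightarrow>\<^sub>L 'a"
  assumes A: "A \<in> selfadjoint_ops" "closed (range A)"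
    and B: "B \<in> selfadjoint_ops" "closed (range B)"
    and orth: "\<And>x y. x \<in> range A \<Longrightarrow> y \<in> range B \<Longrightarrow> cinner x y = 0"
    and closed: "closed (range (A - B))"
  shows splitting_range_proj_right:
    "proper_splitting (A - B) (A - range_proj B) (A - range_proj B - (A - B))"
    "splitting_converges (A - range_proj B) (A - range_proj B - (A - B)) \<longleftrightarrow> norm (range_proj B - B) < 1"
  and splitting_range_proj_left:
    "proper_splitting (A - B) (range_proj A - B) (range_proj A - B - (A - B))"
    "splitting_converges (range_proj A - B) (range_proj A - B - (A - B)) \<longleftrightarrow> norm (range_proj A - A) < 1"
proof -
  let ?P = "range_proj A" and ?Q = "range_proj B"
  have A': "A \<in> bounded_ops" and B': "B \<in> bounded_ops"
    using A B by (auto intro: selfadjoint_imp_bounded_ops)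
  note P = is_range_proj[OF A' A(2)] and Q = is_range_proj[OF B' B(2)]
  have AB: "A y = 0" if "y \<in> range B" for y
    unfolding selfadjoint_orthogonal_range[OF A(1)] using orth that cinner_eq_zero_swap by blast
  have BA: "B x = 0" if "x \<in> range A" for x
    unfolding selfadjoint_orthogonal_range[OF B(1)] using orth that by blast
  have rP: "range ?P = range A" and rQ: "range ?Q = range B"
    by (simp_all only: range_range_proj[OF A' A(2)] range_range_proj[OF B' B(2)])
  have nP: "nullspace ?P = nullspace A" and nQ: "nullspace ?Q = nullspace B"
    by (simp_all only: nullspace_range_proj[OF A] nullspace_range_proj[OF B])
  note AB_eqs = orthogonal_ranges_diff[OF A B orth]
  have AQ_eqs: "range (A - ?Q) = range (A - B)" "nullspace (A - ?Q) = nullspace (A - B)"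
    using orthogonal_ranges_diff[OF A Q(1)] AB_eqs by (simp_all add: rQ nQ B orth)
  have PB_eqs: "range (?P - B) = range (A - B)" "nullspace (?P - B) = nullspace (A - B)"
    using orthogonal_ranges_diff[OF P(1) _ B] AB_eqs by (simp_all add: rP nP A orth)
  have sa: "A - ?Q \<in> selfadjoint_ops" "?P - B \<in> selfadjoint_ops"
    "?Q - B \<in> selfadjoint_ops" "?P - A \<in> selfadjoint_ops"
    using A B P Q by (auto intro: selfadjoint_diff)
  show "proper_splitting (A - B) (A - ?Q) (A - ?Q - (A - B))"
    "proper_splitting (A - B) (?P - B) (?P - B - (A - B))"
    using sa A' B' AQ_eqs PB_eqs selfadjoint_imp_bounded_ops[OF P(1)]
      selfadjoint_imp_bounded_ops[OF Q(1)]
    by (auto simp: proper_splitting_def intro: bounded_ops_diff selfadjoint_imp_bounded_ops)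
  have rangeQ: "(?Q - B) x \<in> range B" for x
    using Q by (simp add: blinfun.diff_left csubspace_diff csubspace_range B')
  have rangeP: "(?P - A) x \<in> range A" for x
    using P by (simp add: blinfun.diff_left csubspace_diff csubspace_range A')
  \<comment> \<open>On the range of \<open>B\<close> the operator \<open>A - ?Q\<close> is minus the
    identity. This supplies the preimages for \<open>WQ\<close> and the factorization of
    \<open>?U - T\<close> as \<open>(A - ?Q) (?Q - B)\<close>, where \<open>?U = A - ?Q\<close> and
    \<open>T = A - B\<close>.\<close>
  have UQ: "(A - ?Q) y = - y" if "y \<in> range B" for y
    using that by (simp add: blinfun.diff_left AB range_proj_fixes[OF B' B(2)])
  \<comment> \<open>On the range of \<open>A\<close> the operator \<open>?P - B\<close> is the
    identity, so here the factorization carries no sign change.\<close>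
  have UP: "(?P - B) x = x" if "x \<in> range A" for x
    using that by (simp add: blinfun.diff_left BA range_proj_fixes[OF A' A(2)])
  have WQ: "range (?Q - B) \<subseteq> range (A - ?Q)"
  proof (rule image_subsetI)
    show "(?Q - B) x \<in> range (A - ?Q)" for x
      by (rule range_eqI[of _ _ "- (?Q - B) x"]) (simp add: UQ rangeQ blinfun.minus_right)
  qed
  have "A - ?Q - (A - B) = (A - ?Q) o\<^sub>L (?Q - B)"
    by (rule blinfun_eqI) (simp add: UQ rangeQ, simp add: blinfun.diff_left)
  then show "splitting_converges (A - ?Q) (A - ?Q - (A - B)) \<longleftrightarrow> norm (?Q - B) < 1"
    using splitting_converges_iff[OF sa(1) _ sa(3) WQ] closed by (simp only: AQ_eqs(1))
  have WP: "range (?P - A) \<subseteq> range (?P - B)"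
  proof (rule image_subsetI)
    show "(?P - A) x \<in> range (?P - B)" for x
      by (rule range_eqI[of _ _ "(?P - A) x"]) (simp add: UP rangeP)
  qed
  have "?P - B - (A - B) = (?P - B) o\<^sub>L (?P - A)"
    by (rule blinfun_eqI) (simp add: UP rangeP)
  then show "splitting_converges (?P - B) (?P - B - (A - B)) \<longleftrightarrow> norm (?P - A) < 1"
    using splitting_converges_iff[OF sa(2) _ sa(4) WP] closed by (simp only: PB_eqs(1))
qed

theorem theorem4p12:
  fixes T T1 T2 :: "'a::complex_hilbert_space \<Rightarrow>\<^sub>L 'a"
  assumes "T \<in> selfadjoint_ops"
    and "closed (range T)"
    and "positive_orthogonal_decomposition T T1 T2"
  shows "(T2 \<noteq> 0 \<longrightarrow>
            proper_splitting T (T1 - range_proj T2) (T1 - range_proj T2 - T) \<and>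
            (splitting_converges (T1 - range_proj T2) (T1 - range_proj T2 - T) \<longleftrightarrow>
               norm (range_proj T2 - T2) < 1)) \<and>
         (T1 \<noteq> 0 \<longrightarrow>
            proper_splitting T (range_proj T1 - T2) (range_proj T1 - T2 - T) \<and>
            (splitting_converges (range_proj T1 - T2) (range_proj T1 - T2 - T) \<longleftrightarrow>
               norm (range_proj T1 - T1) < 1))"
proof -
  have T: "T = T1 - T2" and sa: "T1 \<in> selfadjoint_ops" "T2 \<in> selfadjoint_ops"
    and orth: "\<And>x y. x \<in> range T1 \<Longrightarrow> y \<in> range T2 \<Longrightarrow> cinner x y = 0"
    using assms(3)
    by (auto simp: positive_orthogonal_decomposition_def positive_ops_def closure_subset[THEN subsetD])
  note cl = positive_orthogonal_decomposition_closed_ranges[OF assms(2,3)]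
  note hyps = sa(1) cl(1) sa(2) cl(2) orth assms(2)[unfolded T]
  show ?thesis
    unfolding T using splitting_range_proj_right[OF hyps] splitting_range_proj_left[OF hyps]
    by blast
qed

end
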